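(* Let $A, E\in\mathbb{C}^{n\times n}$ with $E$ invertible and Hermitian, and let $\mathrm{ind}(A)=k$. Suppose that the $E$-weighted core-EP inverse $A^{\mathrm{ep},E}$ exists, and let $X\in\mathbb{C}^{n\times n}$. Then the following statements are equivalent: (i) $X$ is the star $E$-weighted core-EP matrix of $A$, i.e. $X=A^*AA^{\mathrm{ep},E}$. (ii) $XAA^{\mathrm{ep},E}=X$ and $XA^k=A^*A^k$. (iii) $A^{\dagger}AXAA^{\mathrm{ep},E}=X$ and $(A^{\dagger})^*XA^k=A^k$. (iv) $XAA^{\mathrm{ep},E}=X$ and $XA=A^*AA^{\mathrm{ep},E}A$. (v) $XAA^{\mathrm{ep},E}=X$ and $X(A^{\dagger})^*=A^*AA^{\mathrm{ep},E}(A^{\dagger})^*$. (vi) $A^{\dagger}AX=X$ and $(A^{\dagger})^*X=AA^{\mathrm{ep},E}$. (vii) $A^{\dagger}AX=X$ and $A^{\dagger}(A^{\dagger})^*X=A^{\dagger}AA^{\mathrm{ep},E}$. (viii) $A^{\dagger}AX=X$ and $AX=AA^*AA^{\mathrm{ep},E}$. (ix) $XA^{\mathrm{ep},E}A(A^{\dagger})^*X=X$, $A^{\mathrm{ep},E}A(A^{\dagger})^*X=AA^{\mathrm{ep},E}$, and $XA^{\mathrm{ep},E}A(A^{\dagger})^*=A^*A^{\mathrm{ep},E}A(A^{\dagger})^*$. (x) $XA^{\mathrm{ep},E}A(A^{\dagger})^*X=X$, $A^{\mathrm{ep},E}A(A^{\dagger})^*X=AA^{\mathrm{ep},E}$, $XA^{\mathrm{ep},E}A(A^{\dagger})^*=A^*A^{\mathrm{ep},E}A(A^{\dagger})^*$,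 and $A^{\mathrm{ep},E}A(A^{\dagger})^*XA^{\mathrm{ep},E}A(A^{\dagger})^*=A^{\mathrm{ep},E}A(A^{\dagger})^*$.
   Context: $A^*$ is the conjugate transpose of $A$ and $A^\dagger$ is the (ordinary) Moore-Penrose inverse of $A$. The index $\mathrm{ind}(A)$ is the smallest non-negative integer $k$ with $\mathrm{rank}(A^k)=\mathrm{rank}(A^{k+1})$ (with $A^0=I$). For $\mathrm{ind}(A)=k$ and $E$ invertible Hermitian, a matrix $X\in\mathbb{C}^{n\times n}$ is called the $E$-weighted core-EP inverse of $A$, denoted $A^{\mathrm{ep},E}$, if $XA^{k+1}=A^k$, $AX^2=X$, and $(EAX)^*=EAX$; such an $X$ is unique when it exists. The star $E$-weighted core-EP matrix of $A$ is the matrix $A^*AA^{\mathrm{ep},E}$. *)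

theory Defs
  imports "HOL-Analysis.Analysis"
begin

definition conj_transpose :: "complex^'n^'m \<Rightarrow> complex^'m^'n"  (\<open>_\<^sup>H\<close> [1000] 1000)
  where "A\<^sup>H = (\<chi> i j. cnj (A $ j $ i))"

definition hermitian :: "complex^'n^'n \<Rightarrow> bool"
  where "hermitian A \<longleftrightarrow> A\<^sup>H = A"

text \<open>The powers \<open>A ^ k\<close> and products \<open>A * B\<close> that the type \<open>complex^'n^'n\<close> inherits from its
  type class instances are taken entrywise, so the matrix power is defined separately.\<close>

primrec matpow :: "complex^'n^'n \<Rightarrow> nat \<Rightarrow> complex^'n^'n"
  where
    "matpow A 0 = mat 1"
  | "matpow A (Suc k) = A ** matpow A k"

definition matrix_index :: "complex^'n^'n \<Rightarrow> nat"
  where "matrix_index A = (LEAST k. rank (matpow A k) = rank (matpow A (k + 1)))"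

definition is_mp_inverse :: "complex^'n^'m \<Rightarrow> complex^'m^'n \<Rightarrow> bool"
  where "is_mp_inverse A X \<longleftrightarrow>
    A ** X ** A = A \<and> X ** A ** X = X \<and> hermitian (A ** X) \<and> hermitian (X ** A)"

definition mp_inverse :: "complex^'n^'m \<Rightarrow> complex^'m^'n"  (\<open>_\<^sup>\<dagger>\<close> [1000] 1000)
  where "A\<^sup>\<dagger> = (THE X. is_mp_inverse A X)"

definition is_core_EP_inverse :: "complex^'n^'n \<Rightarrow> complex^'n^'n \<Rightarrow> complex^'n^'n \<Rightarrow> bool"
  where "is_core_EP_inverse E A X \<longleftrightarrow>
    X ** matpow A (matrix_index A + 1) = matpow A (matrix_index A) \<and>
    A ** (X ** X) = X \<and>
    hermitian (E ** A ** X)"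

text \<open>Meaningful only if such an \<open>X\<close> exists; for invertible Hermitian \<open>E\<close> it is then unique, see
  \<open>is_core_EP_inverse_unique\<close> below.\<close>

definition core_EP_inverse :: "complex^'n^'n \<Rightarrow> complex^'n^'n \<Rightarrow> complex^'n^'n"
  where "core_EP_inverse E A = (THE X. is_core_EP_inverse E A X)"

definition star_core_EP_matrix :: "complex^'n^'n \<Rightarrow> complex^'n^'n \<Rightarrow> complex^'n^'n"
  where "star_core_EP_matrix E A = A\<^sup>H ** A ** core_EP_inverse E A"


subsection \<open>The notions above are well defined\<close>

lemma conj_transpose_conj_transpose [simp]: "(A\<^sup>H)\<^sup>H = A"
  by (simp add: conj_transpose_def vec_eq_iff)

lemma conj_transpose_mult: "(A ** B)\<^sup>H = B\<^sup>H ** A\<^sup>H"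
  by (simp add: conj_transpose_def vec_eq_iff matrix_matrix_mult_def mult.commute)

lemma rank_mult_le: "rank (A ** B) \<le> rank B" for A :: "complex^'n^'m" and B :: "complex^'k^'n"
proof -
  have "row i (A ** B) \<in> vec.span (rows B)" for i
  proof -
    have "row i (A ** B) = (\<Sum>k\<in>UNIV. A $ i $ k *s row k B)"
      by (simp add: vec_eq_iff row_def matrix_matrix_mult_def)
    moreover have "(\<Sum>k\<in>UNIV. A $ i $ k *s row k B) \<in> vec.span (rows B)"
      by (intro vec.span_sum vec.span_scale vec.span_base) (auto simp: rows_def)
    ultimately show ?thesis by simp
  qed
  then have "rows (A ** B) \<subseteq> vec.span (rows B)"
    by (auto simp: rows_def)
  then show ?thesis
    unfolding row_rank_def_gen using vec.dim_mono by blast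
qed

lemma matrix_index_rank:
  "rank (matpow A (matrix_index A)) = rank (matpow A (matrix_index A + 1))"
proof -
  obtain k where "\<And>j. rank (matpow A k) \<le> rank (matpow A j)"
    using ex_has_least_nat [of "\<lambda>_. True" 0 "\<lambda>k. rank (matpow A k)"] by blast
  then have "rank (matpow A k) = rank (matpow A (k + 1))"
    using rank_mult_le [of A "matpow A k"] by (metis Suc_eq_plus1 le_antisym matpow.simps(2))
  then show ?thesis
    unfolding matrix_index_def by (rule LeastI)
qed

lemma conj_transpose_mult_eq_0: "A\<^sup>H ** A = 0 \<Longrightarrow> A = 0"
proof -
  assume 0: "A\<^sup>H ** A = 0"
  have "A $ k $ i = 0" for k i
  proof -
    have "of_real (\<Sum>k\<in>UNIV. (cmod (A $ k $ i))\<^sup>2) = (\<Sum>k\<in>UNIV. cnj (A $ k $ i) * A $ k $ i)"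
      by (simp add: complex_norm_square mult.commute del: of_real_power)
    also have "\<dots> = (A\<^sup>H ** A) $ i $ i"
      by (simp add: conj_transpose_def matrix_matrix_mult_def)
    also have "\<dots> = of_real 0"
      by (simp add: 0)
    finally have "(\<Sum>k\<in>UNIV. (cmod (A $ k $ i))\<^sup>2) = 0"
      by (simp only: of_real_eq_iff)
    then have "(cmod (A $ k $ i))\<^sup>2 = 0"
      by (subst (asm) sum_nonneg_eq_0_iff) auto
    then show ?thesis by simp
  qed
  then show "A = 0" by (simp add: vec_eq_iff)
qed

lemma matrix_sub_ldistrib: "A ** (B - C) = A ** B - A ** C" for A :: "'a::ring_1^'n^'m"
  by (simp add: vec_eq_iff matrix_matrix_mult_def right_diff_distrib sum_subtractf)

lemma conj_transpose_cancel:
  assumes "A\<^sup>H ** A ** Y = A\<^sup>H ** A ** Z"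
  shows "A ** Y = A ** Z"
proof -
  have "A\<^sup>H ** (A ** (Y - Z)) = 0"
    using assms by (simp add: matrix_sub_ldistrib matrix_mul_assoc)
  then have "(A ** (Y - Z))\<^sup>H ** (A ** (Y - Z)) = 0"
    by (metis conj_transpose_mult matrix_mul_assoc times0_right)
  then have "A ** (Y - Z) = 0"
    by (rule conj_transpose_mult_eq_0)
  then show ?thesis by (simp add: matrix_sub_ldistrib)
qed

lemma conj_transpose_factor: "\<exists>G. A = A ** A\<^sup>H ** A ** G" for A :: "complex^'n^'m"
proof -
  define H where "H = A\<^sup>H ** A"
  let ?L = "\<lambda>Z :: complex^'n^'n. H ** Z"
  have H: "H\<^sup>H = H" by (simp add: H_def conj_transpose_mult)
  have lin: "linear ?L"
    by (rule linearI)
      (simp_all add: vec_eq_iff matrix_matrix_mult_def scaleR_sum_right distrib_left sum.distrib)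
  have inj: "inj_on ?L (range ?L)"
  proof (rule inj_onI)
    fix Y Z assume "Y \<in> range ?L" "Z \<in> range ?L" "H ** Y = H ** Z"
    then obtain Y' Z' where "Y = H ** Y'" "Z = H ** Z'" "H\<^sup>H ** H ** Y' = H\<^sup>H ** H ** Z'"
      by (auto simp: H matrix_mul_assoc)
    then show "Y = Z" using conj_transpose_cancel by blast
  qed
  have sub: "subspace (range ?L)"
    using lin by (simp add: linear_subspace_image)
  have "?L ` range ?L = range ?L"
  proof (rule subspace_dim_equal)
    show "subspace (?L ` range ?L)" using lin sub by (rule linear_subspace_image)
    show "subspace (range ?L)" by (rule sub)
    show "?L ` range ?L \<subseteq> range ?L" by auto
    show "dim (range ?L) \<le> dim (?L ` range ?L)"
      using dim_image_eq [OF lin] inj sub by (simp add: span_eq_iff [THEN iffD2])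
  qed
  moreover have "H \<in> range ?L" by (rule range_eqI [of _ _ "mat 1"]) simp
  ultimately obtain G where "H = H ** (H ** G)" by auto
  then have "A\<^sup>H ** A ** mat 1 = A\<^sup>H ** A ** (H ** G)" by (simp add: H_def)
  then have "A ** mat 1 = A ** (H ** G)" by (rule conj_transpose_cancel)
  then show ?thesis by (auto simp: H_def matrix_mul_assoc)
qed

lemma mp_inverse_exists: "\<exists>X. is_mp_inverse A X"
proof -
  obtain G where G: "A = A ** A\<^sup>H ** (A ** G)"
    using conj_transpose_factor [of A] by (auto simp: matrix_mul_assoc)
  obtain K where K: "A\<^sup>H = A\<^sup>H ** A ** (A\<^sup>H ** K)"
    using conj_transpose_factor [of "A\<^sup>H"] by (auto simp: matrix_mul_assoc)
  define C where "C = (A ** G)\<^sup>H"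
  define B where "B = A\<^sup>H ** K"
  have C: "A = A ** A\<^sup>H ** C\<^sup>H" using G by (simp add: C_def)
  have B: "A = B\<^sup>H ** A\<^sup>H ** A"
    using arg_cong [OF K, of conj_transpose]
    by (simp add: B_def conj_transpose_mult matrix_mul_assoc)
  have "C ** A = C ** A ** (C ** A)\<^sup>H"
    using arg_cong [OF C, of "\<lambda>M. C ** M"] by (simp add: conj_transpose_mult matrix_mul_assoc)
  then have CA: "(C ** A)\<^sup>H = C ** A"
    by (metis conj_transpose_mult conj_transpose_conj_transpose)
  have "A ** B = (A ** B)\<^sup>H ** (A ** B)"
    using arg_cong [OF B, of "\<lambda>M. M ** B"] unfolding conj_transpose_mult matrix_mul_assoc .
  then have AB: "(A ** B)\<^sup>H = A ** B"
    by (metis conj_transpose_mult conj_transpose_conj_transpose)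
  have ACA: "A ** C ** A = A"
    using C CA by (metis conj_transpose_mult matrix_mul_assoc)
  have ABA: "A ** B ** A = A"
    using B AB by (metis conj_transpose_mult matrix_mul_assoc)
  have "A ** (C ** A ** B) = A ** B" "(C ** A ** B) ** A = C ** A"
    using ACA ABA by (simp_all add: matrix_mul_assoc) (metis matrix_mul_assoc)
  moreover have "C ** A ** (C ** A ** B) = C ** A ** B"
    using ACA by (metis matrix_mul_assoc)
  ultimately have "is_mp_inverse A (C ** A ** B)"
    unfolding is_mp_inverse_def hermitian_def using AB CA ABA by metis
  then show ?thesis ..
qed

lemma is_mp_inverse_unique:
  assumes "is_mp_inverse A X" "is_mp_inverse A Y"
  shows "X = Y"
proof -
  have X: "A ** X ** A = A" "X ** A ** X = X" "(A ** X)\<^sup>H = A ** X" "(X ** A)\<^sup>H = X ** A"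
    and Y: "A ** Y ** A = A" "Y ** A ** Y = Y" "(A ** Y)\<^sup>H = A ** Y" "(Y ** A)\<^sup>H = Y ** A"
    using assms by (simp_all add: is_mp_inverse_def hermitian_def)
  have "A ** X = A ** Y ** (A ** X)" using Y(1) by (simp add: matrix_mul_assoc)
  then have "A ** X = A ** X ** (A ** Y)" using X(3) Y(3) by (metis conj_transpose_mult)
  then have 1: "A ** X = A ** Y" using X(1) by (simp add: matrix_mul_assoc)
  have "X ** A = X ** A ** (Y ** A)" using Y(1) by (metis matrix_mul_assoc)
  then have "X ** A = Y ** A ** (X ** A)" using X(4) Y(4) by (metis conj_transpose_mult)
  then have 2: "X ** A = Y ** A" using X(1) by (metis matrix_mul_assoc)
  show ?thesis using 1 2 X(2) Y(2) by (metis matrix_mul_assoc)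
qed

lemma is_mp_inverse_mp_inverse: "is_mp_inverse A (A\<^sup>\<dagger>)"
  unfolding mp_inverse_def
  by (rule theI') (use mp_inverse_exists is_mp_inverse_unique in blast)

lemma matpow_Suc_right: "matpow A (Suc k) = matpow A k ** A"
  by (induction k) (simp_all add: matrix_mul_assoc)

lemma is_core_EP_inverse_factor:
  assumes "is_core_EP_inverse E A X"
  shows "\<exists>Z. X = matpow A j ** Z"
proof (induction j)
  case 0
  show ?case by (rule exI [of _ X]) simp
next
  case (Suc j)
  then obtain Z where "X = matpow A j ** Z" ..
  moreover have "X = A ** (X ** X)" using assms by (simp add: is_core_EP_inverse_def)
  ultimately have "X = matpow A (Suc j) ** (Z ** X)" by (metis matpow.simps(2) matrix_mul_assoc)
  then show ?case ..
qed

lemma is_core_EP_inverse_left_id: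
  assumes "is_core_EP_inverse E A X" "is_core_EP_inverse E A Y"
  shows "X ** A ** Y = Y"
proof -
  have X: "X ** matpow A (Suc (matrix_index A)) = matpow A (matrix_index A)"
    using assms(1) by (simp add: is_core_EP_inverse_def del: matpow.simps)
  obtain Z where Z: "Y = matpow A (matrix_index A) ** Z"
    using is_core_EP_inverse_factor [OF assms(2)] by blast
  show "X ** A ** Y = Y"
    using X by (simp add: Z matrix_mul_assoc)
qed

lemma is_core_EP_inverse_unique:
  assumes E: "invertible E" and H: "hermitian E"
    and X: "is_core_EP_inverse E A X" and Y: "is_core_EP_inverse E A Y"
  shows "X = Y"
proof -
  note lX = is_core_EP_inverse_left_id [OF X] and lY = is_core_EP_inverse_left_id [OF Y]
  have hX: "(E ** A ** X)\<^sup>H = E ** A ** X" and hY: "(E ** A ** Y)\<^sup>H = E ** A ** Y"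
    using X Y by (simp_all add: is_core_EP_inverse_def hermitian_def)
  have absX: "M ** A ** X ** A ** Y = M ** A ** Y" for M using lX[OF Y] by (metis matrix_mul_assoc)
  have absY: "M ** A ** Y ** A ** X = M ** A ** X" for M using lY[OF X] by (metis matrix_mul_assoc)
  have sX: "X\<^sup>H ** A\<^sup>H ** E = E ** A ** X" and sY: "Y\<^sup>H ** A\<^sup>H ** E = E ** A ** Y"
    using hX hY H by (simp_all add: conj_transpose_mult hermitian_def matrix_mul_assoc)
  have "E ** A ** X = E ** A ** Y ** A ** X" by (simp add: absY)
  then have "(E ** A ** X)\<^sup>H = (E ** A ** Y ** A ** X)\<^sup>H" by simp
  also have "\<dots> = X\<^sup>H ** A\<^sup>H ** (Y\<^sup>H ** A\<^sup>H ** E)"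
    using H by (simp add: conj_transpose_mult hermitian_def matrix_mul_assoc)
  also have "\<dots> = E ** A ** X ** A ** Y" by (simp add: sY sX matrix_mul_assoc)
  also have "\<dots> = E ** A ** Y" by (rule absX)
  finally have "E ** (A ** X) = E ** (A ** Y)" by (simp add: hX matrix_mul_assoc)
  then have "A ** X = A ** Y"
    using E by (metis invertible_def matrix_mul_assoc matrix_mul_lid)
  then show ?thesis
    using lX[OF X] lX[OF Y] by (metis matrix_mul_assoc)
qed

lemma is_core_EP_inverse_core_EP_inverse:
  assumes "invertible E" "hermitian E" "\<exists>X. is_core_EP_inverse E A X"
  shows "is_core_EP_inverse E A (core_EP_inverse E A)"
  unfolding core_EP_inverse_def
  by (rule theI') (use assms is_core_EP_inverse_unique in blast)

end

(* The products D\<^sup>H A\<^sup>H A = A and D A A\<^sup>H = A\<^sup>H with the Moore-Penrose inverse D convert between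
   X and A W, while A W is an idempotent with the same range as A ^ k, so that multiplying by A W on
   the right and multiplying by A ^ k on the right carry the same information. *)
theory Submission
  imports Defs
begin

lemma mp_inverse_mult:
  shows "A ** A\<^sup>\<dagger> ** A = A" and "A\<^sup>\<dagger> ** A ** A\<^sup>\<dagger> = A\<^sup>\<dagger>"
    and "(A\<^sup>\<dagger>)\<^sup>H ** A\<^sup>H = A ** A\<^sup>\<dagger>" and "A\<^sup>H ** (A\<^sup>\<dagger>)\<^sup>H = A\<^sup>\<dagger> ** A"
  using is_mp_inverse_mp_inverse [of A]
  by (simp_all add: is_mp_inverse_def hermitian_def conj_transpose_mult)

text \<open>The last two are adjoints of Penrose equations, rewritten with the Hermitian products
  \<open>A ** A\<^sup>\<dagger>\<close> and \<open>A\<^sup>\<dagger> ** A\<close>.\<close>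

lemma mp_inverse_absorb:
  shows "(A\<^sup>\<dagger>)\<^sup>H ** A\<^sup>H ** A = A" and "A\<^sup>\<dagger> ** A ** A\<^sup>H = A\<^sup>H"
    and "A ** A\<^sup>\<dagger> ** (A\<^sup>\<dagger>)\<^sup>H = (A\<^sup>\<dagger>)\<^sup>H"
proof -
  show "(A\<^sup>\<dagger>)\<^sup>H ** A\<^sup>H ** A = A" by (simp add: mp_inverse_mult)
  have "(A ** A\<^sup>\<dagger> ** A)\<^sup>H = A\<^sup>H ** (A\<^sup>\<dagger>)\<^sup>H ** A\<^sup>H"
    by (simp add: conj_transpose_mult matrix_mul_assoc)
  then show "A\<^sup>\<dagger> ** A ** A\<^sup>H = A\<^sup>H" by (simp add: mp_inverse_mult)
  have "(A\<^sup>\<dagger> ** A ** A\<^sup>\<dagger>)\<^sup>H = (A\<^sup>\<dagger>)\<^sup>H ** A\<^sup>H ** (A\<^sup>\<dagger>)\<^sup>H"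
    by (simp add: conj_transpose_mult matrix_mul_assoc)
  then show "A ** A\<^sup>\<dagger> ** (A\<^sup>\<dagger>)\<^sup>H = (A\<^sup>\<dagger>)\<^sup>H" by (simp add: mp_inverse_mult)
qed

text \<open>All four follow from \<open>A ** (W ** W) = W\<close>, from \<open>W\<close> undoing one
  factor \<open>A\<close> in front of the power \<open>matpow A (matrix_index A)\<close>, and from
  \<open>W\<close> factoring through that power.\<close>

lemma is_core_EP_inverse_mult:
  assumes "is_core_EP_inverse E A W"
  shows "W ** A ** W = W" and "A ** W ** W = W" and "W ** A ** A ** W = A ** W"
    and "A ** W ** matpow A (matrix_index A) = matpow A (matrix_index A)"
proof -
  let ?P = "matpow A (matrix_index A)"
  show WAW: "W ** A ** W = W" by (rule is_core_EP_inverse_left_id [OF assms assms])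
  have W: "W ** (A ** ?P) = ?P" and AWW: "A ** (W ** W) = W"
    using assms by (simp_all add: is_core_EP_inverse_def)
  show "A ** W ** W = W" using AWW by (simp add: matrix_mul_assoc)
  show "A ** W ** ?P = ?P" using W AWW by (metis matrix_mul_assoc)
  obtain Z where Z: "W = ?P ** Z" using is_core_EP_inverse_factor [OF assms] by blast
  \<comment> \<open>Only the last \<open>W\<close> is expanded; since \<open>A\<close> commutes with
    its powers, the remaining \<open>W\<close> meets \<open>A ** ?P\<close> and turns it into
    \<open>?P\<close>.\<close>
  have "W ** A ** A ** W = W ** (A ** ?P) ** A ** Z"
    by (subst (2) Z) (metis matpow.simps(2) matpow_Suc_right matrix_mul_assoc)
  also have "\<dots> = A ** W"
    by (subst (2) Z) (metis W matpow.simps(2) matpow_Suc_right matrix_mul_assoc)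
  finally show "W ** A ** A ** W = A ** W" .
qed

theorem theorem4p5:
  fixes A E X :: "complex^'n^'n" and k :: nat
  assumes "invertible E" and "hermitian E"
    and "matrix_index A = k"
    and "\<exists>Y. is_core_EP_inverse E A Y"
  shows "let W = core_EP_inverse E A;
      i = (X = star_core_EP_matrix E A);
      ii = (X ** A ** W = X \<and> X ** matpow A k = A\<^sup>H ** matpow A k);
      iii = (A\<^sup>\<dagger> ** A ** X ** A ** W = X \<and> (A\<^sup>\<dagger>)\<^sup>H ** X ** matpow A k = matpow A k);
      iv = (X ** A ** W = X \<and> X ** A = A\<^sup>H ** A ** W ** A);
      v = (X ** A ** W = X \<and> X ** (A\<^sup>\<dagger>)\<^sup>H = A\<^sup>H ** A ** W ** (A\<^sup>\<dagger>)\<^sup>H);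
      vi = (A\<^sup>\<dagger> ** A ** X = X \<and> (A\<^sup>\<dagger>)\<^sup>H ** X = A ** W);
      vii = (A\<^sup>\<dagger> ** A ** X = X \<and> A\<^sup>\<dagger> ** (A\<^sup>\<dagger>)\<^sup>H ** X = A\<^sup>\<dagger> ** A ** W);
      viii = (A\<^sup>\<dagger> ** A ** X = X \<and> A ** X = A ** A\<^sup>H ** A ** W);
      ix = (X ** W ** A ** (A\<^sup>\<dagger>)\<^sup>H ** X = X \<and>
            W ** A ** (A\<^sup>\<dagger>)\<^sup>H ** X = A ** W \<and>
            X ** W ** A ** (A\<^sup>\<dagger>)\<^sup>H = A\<^sup>H ** W ** A ** (A\<^sup>\<dagger>)\<^sup>H);
      x = (X ** W ** A ** (A\<^sup>\<dagger>)\<^sup>H ** X = X \<and>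
           W ** A ** (A\<^sup>\<dagger>)\<^sup>H ** X = A ** W \<and>
           X ** W ** A ** (A\<^sup>\<dagger>)\<^sup>H = A\<^sup>H ** W ** A ** (A\<^sup>\<dagger>)\<^sup>H \<and>
           W ** A ** (A\<^sup>\<dagger>)\<^sup>H ** X ** W ** A ** (A\<^sup>\<dagger>)\<^sup>H = W ** A ** (A\<^sup>\<dagger>)\<^sup>H)
    in (i \<longleftrightarrow> ii) \<and> (i \<longleftrightarrow> iii) \<and> (i \<longleftrightarrow> iv) \<and> (i \<longleftrightarrow> v) \<and> (i \<longleftrightarrow> vi) \<and>
       (i \<longleftrightarrow> vii) \<and> (i \<longleftrightarrow> viii) \<and> (i \<longleftrightarrow> ix) \<and> (i \<longleftrightarrow> x)"
proof -
  define W where "W = core_EP_inverse E A"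
  define D where "D = A\<^sup>\<dagger>"
  define P where "P = matpow A k"
  define S where "S = A\<^sup>H ** A ** W"
  have core: "is_core_EP_inverse E A W"
    unfolding W_def by (rule is_core_EP_inverse_core_EP_inverse) fact+
  note W = is_core_EP_inverse_mult [OF core, unfolded assms(3), folded P_def]
  note D = mp_inverse_absorb [of A, folded D_def]
  have ADA: "A ** D ** A = A" and AHDH: "A\<^sup>H ** D\<^sup>H = D ** A"
    by (simp_all add: D_def mp_inverse_mult)
  \<comment> \<open>Writing \<open>W\<close> as \<open>P\<close> times a matrix and moving
    \<open>A\<close> past \<open>P\<close> puts the range of \<open>A ** W\<close> inside that of
    \<open>P\<close>; an identity ending in \<open>P\<close> thus yields one ending in
    \<open>A ** W\<close>.\<close>
  obtain Z where Z: "A ** W = P ** Z"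
    using is_core_EP_inverse_factor [OF core, of k] unfolding P_def
    by (metis matpow.simps(2) matpow_Suc_right matrix_mul_assoc)
  have SAW: "S ** A ** W = S" and SP: "S ** P = A\<^sup>H ** P"
    and DHS: "D\<^sup>H ** S = A ** W" and DAS: "D ** A ** S = S"
    unfolding S_def using W D by (metis matrix_mul_assoc)+
  have WADS: "W ** A ** D\<^sup>H ** S = A ** W"
    using DHS W(3) by (metis matrix_mul_assoc)
  \<comment> \<open>The factor \<open>A ** W\<close> at the end of \<open>S\<close> is absorbed by
    the next \<open>W\<close>.\<close>
  have SWA: "S ** W ** M = A\<^sup>H ** W ** M" for M
    unfolding S_def using W(2) by (metis matrix_mul_assoc)

  \<comment> \<open>Conversely,
    \<open>X = X ** A ** W = X ** P ** Z = A\<^sup>H ** P ** Z = S\<close>.\<close>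
  have ii: "X = S \<longleftrightarrow> X ** A ** W = X \<and> X ** P = A\<^sup>H ** P"
    using SAW SP Z unfolding S_def by (metis matrix_mul_assoc)
  have iii: "X = S \<longleftrightarrow> D ** A ** X ** A ** W = X \<and> D\<^sup>H ** X ** P = P" (is "_ \<longleftrightarrow> ?R")
  proof
    assume "X = S"
    then show ?R using SAW DAS DHS W(4) by metis
  next
    assume R: ?R
    then have "D\<^sup>H ** X ** A ** W = A ** W" using Z by (metis matrix_mul_assoc)
    \<comment> \<open>\<open>D ** A = A\<^sup>H ** D\<^sup>H\<close> exposes the product just
      computed.\<close>
    then have "D ** A ** X ** A ** W = S"
      unfolding S_def using AHDH by (metis matrix_mul_assoc)
    then show "X = S" using R by simp
  qed
  have iv: "X = S \<longleftrightarrow> X ** A ** W = X \<and> X ** A = S ** A"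
    using SAW by metis
  \<comment> \<open>Right multiplication by \<open>A\<^sup>H ** A\<close> turns
    \<open>D\<^sup>H\<close> into \<open>A\<close>, which leads back to the equation in
    (iv).\<close>
  have v: "X = S \<longleftrightarrow> X ** A ** W = X \<and> X ** D\<^sup>H = S ** D\<^sup>H"
    using SAW D(1) by (metis matrix_mul_assoc)
  have vi: "X = S \<longleftrightarrow> D ** A ** X = X \<and> D\<^sup>H ** X = A ** W"
    using DAS DHS AHDH S_def by (metis matrix_mul_assoc)
  \<comment> \<open>Left multiplication by \<open>A\<close> cancels \<open>D\<close>, as
    \<open>A ** D\<close> fixes both \<open>D\<^sup>H\<close> and \<open>A\<close>.\<close>
  have "D ** D\<^sup>H ** X = D ** A ** W \<longleftrightarrow> D\<^sup>H ** X = A ** W"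
    using D(3) ADA by (metis matrix_mul_assoc)
  with vi have vii: "X = S \<longleftrightarrow> D ** A ** X = X \<and> D ** D\<^sup>H ** X = D ** A ** W"
    by simp
  have viii: "X = S \<longleftrightarrow> D ** A ** X = X \<and> A ** X = A ** S"
    using DAS by (metis matrix_mul_assoc)
  have ix: "X = S \<longleftrightarrow> X ** W ** A ** D\<^sup>H ** X = X \<and> W ** A ** D\<^sup>H ** X = A ** W \<and>
      X ** W ** A ** D\<^sup>H = A\<^sup>H ** W ** A ** D\<^sup>H" (is "_ \<longleftrightarrow> ?R")
  proof
    assume "X = S"
    then show ?R using WADS SAW SWA by (metis matrix_mul_assoc)
  next
    assume ?R
    \<comment> \<open>The first, third and second equations, in this order, give \<open>X = X ** W
      ** A ** D\<^sup>H ** X = A\<^sup>H ** W ** A ** D\<^sup>H ** X = A\<^sup>H ** A **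
      W\<close>.\<close>
    then show "X = S" unfolding S_def by (metis matrix_mul_assoc)
  qed
  \<comment> \<open>The last equation of (x) at \<open>X = S\<close>: the left part collapses to
    \<open>A ** W\<close>, which the following \<open>W\<close> absorbs.\<close>
  have "W ** A ** D\<^sup>H ** S ** W ** A ** D\<^sup>H = W ** A ** D\<^sup>H"
    using WADS W(2) by metis
  with ix have x: "X = S \<longleftrightarrow> X ** W ** A ** D\<^sup>H ** X = X \<and> W ** A ** D\<^sup>H ** X = A ** W \<and>
      X ** W ** A ** D\<^sup>H = A\<^sup>H ** W ** A ** D\<^sup>H \<and>
      W ** A ** D\<^sup>H ** X ** W ** A ** D\<^sup>H = W ** A ** D\<^sup>H"
    by blast
  have S: "star_core_EP_matrix E A = S" "A\<^sup>H ** A ** W = S" "A ** A\<^sup>H ** A ** W = A ** S"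
    by (simp_all add: star_core_EP_matrix_def S_def W_def matrix_mul_assoc)
  show ?thesis
    unfolding Let_def W_def [symmetric] D_def [symmetric] P_def [symmetric] S
    by (intro conjI ii iii iv v vi vii viii ix x)
qed

end
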